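(* Consider the plant $\dot x=f(x,z,u)$, $\epsilon\dot z=g(x,z,u)$ with feedback $u=k(x+e)$, and suppose: (1) $f$, $g$ and $k$ are globally Lipschitz; (2) Assumption A1 holds and the selected root $h$ is globally Lipschitz; (3) there exist symmetric positive definite matrices $P_1\in\mathbb{R}^{n_x\times n_x}$, $P_2\in\mathbb{R}^{n_y\times n_y}$ and constants $\bar\alpha_1,\alpha_2>0$ such that $V_x(x):=x^TP_1x$ and $V_y(x,y):=y^TP_2y$ satisfy, for all $(x,y,e)$, $$\tfrac{\partial V_x}{\partial x}f_s(x,0)\le-\bar\alpha_1V_x(x),\qquad \tfrac{\partial V_y}{\partial y}g_f(x,y,e)\le-\alpha_2V_y(x,y).$$ Then Assumptions A2, A3, A4, A5 and A6 are satisfied (with these $V_x,V_y$, with $\alpha_1=\bar\alpha_1/2$, and with $\gamma_1(s)=\bar\gamma_1s^2$, $\gamma_2(s)=\bar\gamma_2s^2$ for some constants $\bar\gamma_1,\bar\gamma_2\ge0$).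
   Context: Plant: $f:\mathbb{R}^{n_x}\times\mathbb{R}^{n_z}\times\mathbb{R}^{n_u}\to\mathbb{R}^{n_x}$, $g:\mathbb{R}^{n_x}\times\mathbb{R}^{n_z}\times\mathbb{R}^{n_u}\to\mathbb{R}^{n_z}$, $\epsilon>0$, $k:\mathbb{R}^{n_x}\to\mathbb{R}^{n_u}$; $n_y:=n_z$; $|\cdot|$ is the Euclidean norm (induced norm for matrices); $\mathcal{K}_\infty$ denotes continuous, zero-at-zero, strictly increasing, unbounded functions $\mathbb{R}_{\ge0}\to\mathbb{R}_{\ge0}$. Assumption A1: $g(x,z,u)=0$ has $n\ge1$ isolated real roots $z=h_i(x,u)$, each continuously differentiable; one root is fixed and denoted $h$. With $\frac{\partial h}{\partial x}$ the Jacobian of $h$ in its first argument at $(x,k(x+e))$ define: $f_x(x,y,e):=f(x,y+h(x,k(x+e)),k(x+e))$, $h_y(x,y,e):=y+h(x,k(x+e))-h(x,k(x))$, $f_s(x,e):=f(x,h(x,k(x+e)),k(x+e))$, $g_f(x,y,e):=g(x,y+h(x,k(x+e)),k(x+e))$. Assumption A2: there exist a $C^1$ function $V_x:\mathbb{R}^{n_x}\to\mathbb{R}_{\ge0}$, $\underline\alpha_x,\overline\alpha_x,\gamma_1\in\mathcal{K}_\infty$ ($\gamma_1$ continuously differentiable) and $\alpha_1>0$ with $\underline\alpha_x(|x|)\le V_x(x)\le\overline\alpha_x(|x|)$ and $\frac{\partial V_x}{\partial x}f_s(x,e)\le-\alpha_1V_x(x)+\gamma_1(|e|)$ for all $(x,e)$.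 Assumption A3: there exist a $C^1$ function $V_y:\mathbb{R}^{n_x}\times\mathbb{R}^{n_y}\to\mathbb{R}_{\ge0}$, $\underline\alpha_y,\overline\alpha_y\in\mathcal{K}_\infty$, $\alpha_2>0$ with $\underline\alpha_y(|y|)\le V_y(x,y)\le\overline\alpha_y(|y|)$ and $\frac{\partial V_y}{\partial y}g_f(x,y,e)\le-\alpha_2V_y(x,y)$ for all $(x,y,e)$. Assumption A4: there exist $\gamma_2\in\mathcal{K}_\infty$ and $\beta_1,\beta_2,\beta_3>0$ with, for all $(x,y,e)$, $\frac{\partial V_x}{\partial x}[f_x(x,y,e)-f_s(x,e)]\le\beta_1\sqrt{V_x(x)V_y(x,y)}$ and $[\frac{\partial V_y}{\partial x}-\frac{\partial V_y}{\partial y}\frac{\partial h}{\partial x}]f_x(x,y,e)\le\beta_2\sqrt{V_x(x)V_y(x,y)}+\beta_3V_y(x,y)+\gamma_2(|e|)$; and there is $L>0$ with $\gamma_2\circ\gamma_1^{-1}(s)\le Ls$ for all $s\ge0$. Assumption A5: there exist $\lambda_1,\lambda_2>0$ with $V_y(x,h_y(x,y,e))\le V_y(x,y)+\lambda_1\gamma_1(|e|)+\lambda_2\sqrt{\gamma_1(|e|)V_y(x,y)}$ for all $(x,y,e)$. Assumption A6: there exist $M,N\ge0$ such that for all $(x,y)$ and almost all $e$: $\langle\nabla|e|,-f_x(x,y,e)\rangle\le M|e|+N(\sqrt{V_x(x)}+\sqrt{V_y(x,y)})$. *)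

theory Defs
  imports "HOL-Analysis.Analysis"
begin

text \<open>Class K-infinity: functions on the nonnegative reals that are continuous,
  zero at zero, strictly increasing and unbounded.\<close>
definition Kinf :: "(real \<Rightarrow> real) \<Rightarrow> bool" where
  "Kinf a \<longleftrightarrow> continuous_on {0..} a \<and> a 0 = 0 \<and> strict_mono_on {0..} a
     \<and> (\<forall>M. \<exists>s\<ge>0. M < a s)"

text \<open>Continuously differentiable (C1) on the whole space.\<close>
definition C1 :: "('a::real_normed_vector \<Rightarrow> 'b::real_normed_vector) \<Rightarrow> bool" where
  "C1 F \<longleftrightarrow> (\<exists>F'. (\<forall>p. (F has_derivative blinfun_apply (F' p)) (at p)) \<and> continuous_on UNIV F')"

text \<open>Globally Lipschitz.\<close>
definition glob_lipschitz :: "('a::metric_space \<Rightarrow> 'b::metric_space) \<Rightarrow> bool" where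
  "glob_lipschitz F \<longleftrightarrow> (\<exists>C. C-lipschitz_on UNIV F)"

text \<open>Quadratic form x^T P x.\<close>
definition quadf :: "real^'n^'n \<Rightarrow> real^'n \<Rightarrow> real" where
  "quadf P x = x \<bullet> (P *v x)"

definition sym_pos_def_mat :: "real^'n^'n \<Rightarrow> bool" where
  "sym_pos_def_mat P \<longleftrightarrow> transpose P = P \<and> (\<forall>x. x \<noteq> 0 \<longrightarrow> 0 < x \<bullet> (P *v x))"

text \<open>Assumption A1 for the selected root h.\<close>
definition A1 :: "('x::real_normed_vector \<Rightarrow> 'z::real_normed_vector \<Rightarrow> 'u::real_normed_vector \<Rightarrow> 'z)
     \<Rightarrow> ('x \<Rightarrow> 'u \<Rightarrow> 'z) \<Rightarrow> bool" where
  "A1 g h \<longleftrightarrow> (\<exists>n::nat. n \<ge> 1 \<and> (\<exists>hs :: nat \<Rightarrow> 'x \<Rightarrow> 'u \<Rightarrow> 'z.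
       (\<forall>i<n. C1 (\<lambda>(x, u). hs i x u))
     \<and> (\<forall>x u. {z. g x z u = 0} = (\<lambda>i. hs i x u) ` {..<n} \<and> inj_on (\<lambda>i. hs i x u) {..<n})
     \<and> (\<exists>i<n. h = hs i)))"

text \<open>Auxiliary functions.\<close>
definition fx_fun where
  "fx_fun f h k x y e = f x (y + h x (k (x + e))) (k (x + e))"
definition hy_fun where
  "hy_fun h k x y e = y + h x (k (x + e)) - h x (k x)"
definition fs_fun where
  "fs_fun f h k x e = f x (h x (k (x + e))) (k (x + e))"
definition gf_fun where
  "gf_fun g h k x y e = g x (y + h x (k (x + e))) (k (x + e))"

definition A2 where
  "A2 f h k Vx \<alpha>1 \<gamma>1 \<longleftrightarrow> C1 Vx
     \<and> (\<exists>la ua. Kinf la \<and> Kinf ua \<and> (\<forall>x. la (norm x) \<le> Vx x \<and> Vx x \<le> ua (norm x)))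
     \<and> Kinf \<gamma>1 \<and> C1 \<gamma>1 \<and> \<alpha>1 > 0
     \<and> (\<forall>x e. frechet_derivative Vx (at x) (fs_fun f h k x e) \<le> - \<alpha>1 * Vx x + \<gamma>1 (norm e))"

definition A3 where
  "A3 g h k Vy \<longleftrightarrow> C1 (\<lambda>(x, y). Vy x y)
     \<and> (\<exists>la ua \<alpha>2. Kinf la \<and> Kinf ua \<and> \<alpha>2 > 0
        \<and> (\<forall>x y. la (norm y) \<le> Vy x y \<and> Vy x y \<le> ua (norm y))
        \<and> (\<forall>x y e. frechet_derivative (\<lambda>y'. Vy x y') (at y) (gf_fun g h k x y e) \<le> - \<alpha>2 * Vy x y))"

definition A4 where
  "A4 f h k Vx Vy \<gamma>1 \<gamma>2 \<longleftrightarrow> Kinf \<gamma>2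
     \<and> (\<exists>\<beta>1 \<beta>2 \<beta>3. \<beta>1 > 0 \<and> \<beta>2 > 0 \<and> \<beta>3 > 0 \<and> (\<forall>x y e.
          frechet_derivative Vx (at x) (fx_fun f h k x y e - fs_fun f h k x e)
            \<le> \<beta>1 * sqrt (Vx x * Vy x y)
        \<and> frechet_derivative (\<lambda>x'. Vy x' y) (at x) (fx_fun f h k x y e)
          - frechet_derivative (\<lambda>y'. Vy x y') (at y)
              (frechet_derivative (\<lambda>x'. h x' (k (x + e))) (at x) (fx_fun f h k x y e))
            \<le> \<beta>2 * sqrt (Vx x * Vy x y) + \<beta>3 * Vy x y + \<gamma>2 (norm e)))
     \<and> (\<exists>L>0. \<forall>s\<ge>0. \<gamma>2 (inv_into {0..} \<gamma>1 s) \<le> L * s)"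

definition A5 where
  "A5 h k Vy \<gamma>1 \<longleftrightarrow> (\<exists>lam1 lam2. lam1 > 0 \<and> lam2 > 0 \<and> (\<forall>x y e.
      Vy x (hy_fun h k x y e) \<le> Vy x y + lam1 * \<gamma>1 (norm e) + lam2 * sqrt (\<gamma>1 (norm e) * Vy x y)))"

definition A6 where
  "A6 f h k Vx Vy \<longleftrightarrow> (\<exists>M\<ge>0. \<exists>N\<ge>0. \<forall>x y. AE e in lborel.
      \<forall>D. (norm has_derivative D) (at e) \<longrightarrow>
        D (- fx_fun f h k x y e) \<le> M * norm e + N * (sqrt (Vx x) + sqrt (Vy x y)))"

end

theory Submission
  imports Defs
begin

text \<open>Every condition is a quadratic estimate. A positive definite form \<open>x\<^sup>T P x\<close> lies between
  \<open>c \<bar>x\<bar>\<^sup>2\<close> and \<open>\<parallel>P\<parallel> \<bar>x\<bar>\<^sup>2\<close>, and its derivative in direction \<open>v\<close> is at most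
  \<open>2 \<parallel>P\<parallel> \<bar>x\<bar> \<bar>v\<bar>\<close>. The Lipschitz hypotheses bound how far \<open>f\<^sub>s\<close>, \<open>f\<^sub>x\<close> and the root
  \<open>h\<close> move when \<open>e\<close> or \<open>y\<close> change, linearly in \<open>\<bar>e\<bar>\<close> and \<open>\<bar>y\<bar>\<close>. The decrease of \<open>V\<^sub>x\<close>
  along \<open>f\<^sub>s(\<cdot>, 0)\<close> forces \<open>f\<^sub>s(0, 0) = 0\<close>, so \<open>f\<^sub>x\<close> grows linearly in \<open>(x, y, e)\<close>. The
  cross terms \<open>\<bar>x\<bar> \<bar>e\<bar>\<close> and \<open>\<bar>y\<bar> \<bar>e\<bar>\<close> are split by Young's inequality, which costs half
  of the decay rate \<open>\<alpha>\<^sub>1\<close> and produces the quadratic gains \<open>\<gamma>\<^sub>1\<close>, \<open>\<gamma>\<^sub>2\<close>.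
  The Lipschitz bound on \<open>g\<close> and the value of \<open>\<epsilon>\<close> are not needed, and Assumption A1 is used only
  for the differentiability of \<open>h\<close>.\<close>

lemma inner_matrix_vector_le:
  fixes P :: "real^'n^'m"
  shows "\<bar>v \<bullet> (P *v w)\<bar> \<le> onorm ((*v) P) * norm v * norm w"
proof -
  have "\<bar>v \<bullet> (P *v w)\<bar> \<le> norm v * norm (P *v w)"
    by (rule Cauchy_Schwarz_ineq2)
  also have "\<dots> \<le> norm v * (onorm ((*v) P) * norm w)"
    by (intro mult_left_mono onorm matrix_vector_mul_bounded_linear) simp
  finally show ?thesis
    by (simp add: mult_ac)
qed

lemma onorm_matrix_vector_nonneg: "0 \<le> onorm ((*v) (P :: real^'n^'m))"
  by (rule onorm_pos_le[OF matrix_vector_mul_bounded_linear])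

lemma quadf_le: "quadf P x \<le> onorm ((*v) P) * (norm x)\<^sup>2"
  using inner_matrix_vector_le[of x P x]
  by (simp add: quadf_def power2_eq_square mult.assoc)

lemma quadf_scaleR: "quadf P (a *\<^sub>R x) = a\<^sup>2 * quadf P x"
  by (simp add: quadf_def matrix_vector_mult_scaleR power2_eq_square)

lemma quadf_ge:
  assumes "sym_pos_def_mat P"
  shows "\<exists>c>0. \<forall>x. c * (norm x)\<^sup>2 \<le> quadf P x"
proof -
  have "continuous_on (sphere 0 1) (quadf P)"
    unfolding quadf_def by (intro continuous_intros)
  moreover have "sphere (0::real^'n) 1 \<noteq> {}"
    by simp
  ultimately obtain u where u: "u \<in> sphere 0 1"
    and min: "\<And>y. y \<in> sphere 0 1 \<Longrightarrow> quadf P u \<le> quadf P y"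
    using continuous_attains_inf[OF compact_sphere] by blast
  have "u \<noteq> 0"
    using u by auto
  then have "quadf P u > 0"
    using assms by (simp add: sym_pos_def_mat_def quadf_def)
  moreover have "quadf P u * (norm x)\<^sup>2 \<le> quadf P x" for x
  proof (cases "x = 0")
    case True
    then show ?thesis
      by (simp add: quadf_def)
  next
    case False
    define y where "y = (1 / norm x) *\<^sub>R x"
    have "norm x *\<^sub>R y = x" "y \<in> sphere 0 1"
      using False by (simp_all add: y_def)
    then have "quadf P x = quadf P y * (norm x)\<^sup>2" "quadf P u \<le> quadf P y"
      using quadf_scaleR[of P "norm x" y] min[of y] by (simp_all add: mult.commute)
    then show ?thesis
      by (metis mult_right_mono zero_le_power2)
  qed
  ultimately show ?thesis
    by blast
qed

lemma quadf_nonneg: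
  assumes "sym_pos_def_mat P"
  shows "0 \<le> quadf P x"
  using quadf_ge[OF assms] by (meson order_trans mult_nonneg_nonneg less_imp_le zero_le_power2)

lemma sqrt_quadf_ge:
  assumes "sym_pos_def_mat P"
  shows "\<exists>c>0. \<forall>x. c * norm x \<le> sqrt (quadf P x)"
proof -
  obtain c where "c > 0" "\<And>x. c * (norm x)\<^sup>2 \<le> quadf P x"
    using quadf_ge[OF assms] by blast
  then have "sqrt c * norm x \<le> sqrt (quadf P x)" for x
    by (intro real_le_rsqrt) (simp add: power_mult_distrib)
  with \<open>c > 0\<close> show ?thesis
    by (intro exI[of _ "sqrt c"]) auto
qed

lemma quadf_has_derivative:
  "(quadf P has_derivative (\<lambda>v. v \<bullet> (P *v x) + x \<bullet> (P *v v))) (at x)"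
  unfolding quadf_def
  by (auto intro!: derivative_eq_intros bounded_linear.has_derivative[OF matrix_vector_mul_bounded_linear]
      simp: matrix_vector_mult_diff_distrib)

lemma frechet_derivative_quadf:
  "frechet_derivative (quadf P) (at x) = (\<lambda>v. v \<bullet> (P *v x) + x \<bullet> (P *v v))"
  by (rule frechet_derivative_at[OF quadf_has_derivative, symmetric])

lemma linear_frechet_derivative_quadf: "linear (frechet_derivative (quadf P) (at x))"
  unfolding frechet_derivative_quadf
  using has_derivative_linear[OF quadf_has_derivative] .

lemma frechet_derivative_quadf_le:
  "\<bar>frechet_derivative (quadf P) (at x) v\<bar> \<le> 2 * onorm ((*v) P) * norm x * norm v"
proof -
  have "\<bar>v \<bullet> (P *v x) + x \<bullet> (P *v v)\<bar> \<le> \<bar>v \<bullet> (P *v x)\<bar> + \<bar>x \<bullet> (P *v v)\<bar>"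
    by (rule abs_triangle_ineq)
  also have "\<dots> \<le> onorm ((*v) P) * norm v * norm x + onorm ((*v) P) * norm x * norm v"
    by (intro add_mono inner_matrix_vector_le)
  finally show ?thesis
    by (simp add: frechet_derivative_quadf algebra_simps)
qed

lemma frechet_derivative_quadf_diff:
  "frechet_derivative (quadf P) (at p) v - frechet_derivative (quadf P) (at q) v
     = frechet_derivative (quadf P) (at (p - q)) v"
  by (simp add: frechet_derivative_quadf matrix_vector_mult_diff_distrib inner_diff_left inner_diff_right)

lemma quadf_add:
  "quadf P (x + v) = quadf P x + frechet_derivative (quadf P) (at x) v + quadf P v"
  by (simp add: frechet_derivative_quadf quadf_def matrix_vector_right_distrib inner_add_left inner_add_right)

lemma quadf_add_le:
  "quadf P (x + v) \<le> quadf P x + 2 * onorm ((*v) P) * norm x * norm v + onorm ((*v) P) * (norm v)\<^sup>2"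
  using quadf_add[of P x v] frechet_derivative_quadf_le[of P x v] quadf_le[of P v]
    abs_ge_self[of "frechet_derivative (quadf P) (at x) v"]
  by linarith

lemma C1_if_derivative_lipschitz:
  fixes F :: "'a::real_normed_vector \<Rightarrow> 'b::real_normed_vector"
  assumes deriv: "\<And>p. (F has_derivative D p) (at p)"
    and lipschitz: "\<And>p q v. norm (D p v - D q v) \<le> L * norm (p - q) * norm v"
  shows "C1 F"
proof -
  define F' where "F' p = Blinfun (D p)" for p
  have F': "blinfun_apply (F' p) = D p" for p
    using deriv has_derivative_bounded_linear bounded_linear_Blinfun_apply unfolding F'_def by blast
  have "norm (F' p - F' q) \<le> \<bar>L\<bar> * norm (p - q)" for p q
  proof (rule norm_blinfun_bound)
    fix v :: 'a
    have "L * norm (p - q) * norm v \<le> \<bar>L\<bar> * norm (p - q) * norm v"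
      by (intro mult_right_mono) auto
    then have "norm (D p v - D q v) \<le> \<bar>L\<bar> * norm (p - q) * norm v"
      using lipschitz[where p = p and q = q and v = v] by linarith
    then show "norm ((F' p - F' q) v) \<le> \<bar>L\<bar> * norm (p - q) * norm v"
      by (simp add: blinfun.diff_left F')
  qed simp
  then have "\<bar>L\<bar>-lipschitz_on UNIV F'"
    by (intro lipschitz_onI) (auto simp: dist_norm)
  then have "continuous_on UNIV F'"
    by (rule lipschitz_on_continuous_on)
  then show ?thesis
    unfolding C1_def using deriv F' by metis
qed

lemma C1_quadf: "C1 (quadf P)"
proof (rule C1_if_derivative_lipschitz[OF quadf_has_derivative])
  fix p q v
  show "norm ((v \<bullet> (P *v p) + p \<bullet> (P *v v)) - (v \<bullet> (P *v q) + q \<bullet> (P *v v)))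
      \<le> 2 * onorm ((*v) P) * norm (p - q) * norm v"
    using frechet_derivative_quadf_diff[of P p v q] frechet_derivative_quadf_le[of P "p - q" v]
    by (simp add: frechet_derivative_quadf)
qed

lemma C1_compose_snd:
  fixes F :: "'b::real_normed_vector \<Rightarrow> 'c::real_normed_vector"
  assumes "C1 F"
  shows "C1 (\<lambda>p :: 'a::real_normed_vector \<times> 'b. F (snd p))"
proof -
  obtain F' where deriv: "\<And>p. (F has_derivative blinfun_apply (F' p)) (at p)"
    and cont: "continuous_on UNIV F'"
    using assms unfolding C1_def by blast
  have eq: "blinfun_apply (F' (snd p) o\<^sub>L snd_blinfun) = (\<lambda>v. F' (snd p) (snd v))"
    for p :: "'a \<times> 'b"
    by (rule ext) simp
  have "((\<lambda>p. F (snd p)) has_derivative blinfun_apply (F' (snd p) o\<^sub>L snd_blinfun)) (at p)"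
    for p :: "'a \<times> 'b"
    unfolding eq
    using has_derivative_compose[OF has_derivative_snd[OF has_derivative_ident] deriv[of "snd p"]] .
  moreover have "continuous_on UNIV (\<lambda>p. F' (snd p) o\<^sub>L snd_blinfun)"
    by (intro continuous_intros continuous_on_compose2[OF cont]) auto
  ultimately show ?thesis
    unfolding C1_def by (intro exI[of _ "\<lambda>p. F' (snd p) o\<^sub>L snd_blinfun"]) blast
qed

lemma C1_scaled_square: "C1 (\<lambda>s::real. c * s\<^sup>2)"
proof (rule C1_if_derivative_lipschitz[where D = "\<lambda>p v. 2 * c * p * v" and L = "2 * \<bar>c\<bar>"])
  show "((\<lambda>s. c * s\<^sup>2) has_derivative (\<lambda>v. 2 * c * p * v)) (at p)" for p
    by (auto intro!: derivative_eq_intros simp: power2_eq_square)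
  show "norm (2 * c * p * v - 2 * c * q * v) \<le> 2 * \<bar>c\<bar> * norm (p - q) * norm v" for p q v
    by (simp add: abs_mult flip: right_diff_distrib left_diff_distrib)
qed

lemma Kinf_scaled_square:
  assumes "c > 0"
  shows "Kinf (\<lambda>s. c * s\<^sup>2)"
  unfolding Kinf_def
proof (intro conjI allI)
  show "continuous_on {0..} (\<lambda>s. c * s\<^sup>2)"
    by (intro continuous_intros)
  show "strict_mono_on {0..} (\<lambda>s. c * s\<^sup>2)"
    using assms by (intro strict_mono_onI) (auto intro: power_strict_mono)
  show "\<exists>s\<ge>0. M < c * s\<^sup>2" for M
    using assms by (intro exI[of _ "sqrt ((\<bar>M\<bar> + 1) / c)"]) auto
qed simp

lemma inv_into_scaled_square:
  assumes "c > 0" "s \<ge> 0"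
  shows "inv_into {0..} (\<lambda>s. c * s\<^sup>2) s = sqrt (s / c)"
proof (rule inv_into_f_eq)
  show "inj_on (\<lambda>s. c * s\<^sup>2) {0..}"
    using Kinf_scaled_square[OF assms(1)] strict_mono_on_imp_inj_on unfolding Kinf_def by blast
qed (use assms in auto)

lemma mult_le_weighted_squares:
  fixes a b s :: real
  assumes "s > 0"
  shows "a * b \<le> s * a\<^sup>2 + b\<^sup>2 / (4 * s)"
proof -
  have "4 * s * (a * b) \<le> 4 * s * (s * a\<^sup>2) + b\<^sup>2"
    using zero_le_power2[of "2 * s * a - b"] by (simp add: power2_eq_square algebra_simps)
  also have "\<dots> = 4 * s * (s * a\<^sup>2 + b\<^sup>2 / (4 * s))"
    using assms by (simp add: field_simps)
  finally show ?thesis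
    using assms by simp
qed

lemma le_scaled_bound:
  fixes A s m S :: real
  assumes "A \<ge> 0" "s > 0" "m \<ge> 0" "s * m \<le> S"
  shows "A * m \<le> (A / s + 1) * S"
proof -
  have "A * m = (A / s) * (s * m)"
    using assms(2) by simp
  also have "\<dots> \<le> (A / s) * S"
    using assms by (intro mult_left_mono) auto
  also have "\<dots> \<le> (A / s + 1) * S"
    using assms mult_nonneg_nonneg[of s m] by (simp add: distrib_right)
      (meson less_imp_le mult_nonneg_nonneg order_trans)
  finally show ?thesis .
qed

lemma has_derivative_norm_le_lipschitz:
  fixes F :: "'a::real_normed_vector \<Rightarrow> 'b::real_normed_vector"
  assumes deriv: "(F has_derivative D) (at x)" and lipschitz: "C-lipschitz_on UNIV F"
  shows "norm (D v) \<le> C * norm v"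
proof (rule ccontr)
  assume "\<not> ?thesis"
  then have v: "norm v > 0" and excess: "C * norm v < norm (D v)"
    using lipschitz_on_nonneg[OF lipschitz] linear_0[OF has_derivative_linear[OF deriv]]
    by (auto simp: not_le)
  define \<epsilon> where "\<epsilon> = (norm (D v) - C * norm v) / (2 * norm v)"
  have "\<epsilon> > 0"
    using v excess by (simp add: \<epsilon>_def)
  then obtain \<delta> where "\<delta> > 0"
    and approx: "\<And>y. norm (y - x) < \<delta> \<Longrightarrow> norm (F y - F x - D (y - x)) \<le> \<epsilon> * norm (y - x)"
    using deriv unfolding has_derivative_at_alt by blast
  define t where "t = \<delta> / (2 * norm v)"
  have t: "t > 0" "norm (t *\<^sub>R v) < \<delta>"
    using v \<open>\<delta> > 0\<close> by (auto simp: t_def)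
  define a where "a = F (x + t *\<^sub>R v) - F x"
  have "norm (a - t *\<^sub>R D v) \<le> \<epsilon> * (t * norm v)"
    using approx[of "x + t *\<^sub>R v"] t linear_scale[OF has_derivative_linear[OF deriv]]
    by (simp add: a_def)
  moreover have "norm a \<le> C * (t * norm v)"
    using lipschitz_on_normD[OF lipschitz, of "x + t *\<^sub>R v" x] t by (simp add: a_def)
  moreover have "norm (t *\<^sub>R D v) \<le> norm a + norm (a - t *\<^sub>R D v)"
    using norm_triangle_ineq4[of a "a - t *\<^sub>R D v"] by simp
  moreover have "norm (t *\<^sub>R D v) = t * norm (D v)"
    using t(1) by simp
  ultimately have "t * norm (D v) \<le> \<epsilon> * (t * norm v) + C * (t * norm v)"
    by linarith
  then have "t * norm (D v) \<le> t * ((\<epsilon> + C) * norm v)"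
    by (simp add: algebra_simps)
  then have "norm (D v) \<le> (\<epsilon> + C) * norm v"
    using t(1) by (rule mult_left_le_imp_le)
  also have "\<dots> = (norm (D v) + C * norm v) / 2"
    using v by (simp add: \<epsilon>_def field_simps)
  finally show False
    using excess by simp
qed

lemma lipschitz_on_norm: "1-lipschitz_on UNIV norm"
  by (intro lipschitz_onI) (auto simp: dist_norm norm_triangle_ineq3)

lemma lipschitz_on_uncurried_le:
  assumes "L-lipschitz_on UNIV (\<lambda>(x, u). F x u)"
  shows "norm (F x u - F x' u') \<le> L * (norm (x - x') + norm (u - u'))"
proof -
  have "norm (F x u - F x' u') \<le> L * norm (x - x', u - u')"
    using lipschitz_on_normD[OF assms, of "(x, u)" "(x', u')"] by simp
  also have "\<dots> \<le> L * (norm (x - x') + norm (u - u'))"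
    by (intro mult_left_mono norm_Pair_le lipschitz_on_nonneg[OF assms])
  finally show ?thesis .
qed

lemma lipschitz_on_uncurried3_le:
  assumes "L-lipschitz_on UNIV (\<lambda>(x, z, u). F x z u)"
  shows "norm (F x z u - F x' z' u') \<le> L * (norm (x - x') + norm (z - z') + norm (u - u'))"
proof -
  have "norm (F x z u - F x' z' u') \<le> L * norm (x - x', z - z', u - u')"
    using lipschitz_on_normD[OF assms, of "(x, z, u)" "(x', z', u')"] by simp
  also have "\<dots> \<le> L * (norm (x - x') + norm (z - z') + norm (u - u'))"
    using norm_Pair_le[of "x - x'" "(z - z', u - u')"] norm_Pair_le[of "z - z'" "u - u'"]
    by (intro mult_left_mono lipschitz_on_nonneg[OF assms]) linarith
  finally show ?thesis .
qed

lemma A1_imp_C1: "A1 g h \<Longrightarrow> C1 (\<lambda>(x, u). h x u)"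
  unfolding A1_def by blast

lemma frechet_derivative_partial_le:
  assumes "C1 (\<lambda>(x, u). h x u)" and lipschitz: "L-lipschitz_on UNIV (\<lambda>(x, u). h x u)"
  shows "norm (frechet_derivative (\<lambda>x'. h x' u) (at x) v) \<le> L * norm v"
proof -
  obtain H where H: "((\<lambda>(x, u). h x u) has_derivative H) (at (x, u))"
    using assms(1) unfolding C1_def by blast
  have "((\<lambda>x'. (x', u)) has_derivative (\<lambda>v. (v, 0))) (at x)"
    by (auto intro!: derivative_eq_intros)
  from has_derivative_compose[OF this H]
  have "((\<lambda>x'. h x' u) has_derivative (\<lambda>v. H (v, 0))) (at x)"
    by simp
  then have "frechet_derivative (\<lambda>x'. h x' u) (at x) v = H (v, 0)"
    by (simp add: frechet_derivative_at[symmetric])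
  also have "norm \<dots> \<le> L * norm (v, 0::'b)"
    by (rule has_derivative_norm_le_lipschitz[OF H lipschitz])
  finally show ?thesis
    by (simp add: norm_Pair)
qed

lemma quadf_bounded_by_Kinf:
  assumes "sym_pos_def_mat P"
  shows "\<exists>la ua. Kinf la \<and> Kinf ua \<and> (\<forall>x. la (norm x) \<le> quadf P x \<and> quadf P x \<le> ua (norm x))"
proof -
  obtain c where "c > 0" "\<And>x. c * (norm x)\<^sup>2 \<le> quadf P x"
    using quadf_ge[OF assms] by blast
  moreover have "quadf P x \<le> (onorm ((*v) P) + 1) * (norm x)\<^sup>2" for x
    using quadf_le[of P x] zero_le_power2[of "norm x"] unfolding distrib_right mult_1 by linarith
  moreover have "Kinf (\<lambda>s. (onorm ((*v) P) + 1) * s\<^sup>2)"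
    using onorm_matrix_vector_nonneg[of P] by (intro Kinf_scaled_square) linarith
  ultimately show ?thesis
    using Kinf_scaled_square by blast
qed

lemma quadf_derivative_nonpos_imp_zero:
  assumes P: "sym_pos_def_mat P" and F: "isCont F 0"
    and nonpos: "\<And>x. frechet_derivative (quadf P) (at x) (F x) \<le> 0"
  shows "F 0 = 0"
proof (rule ccontr)
  define c where "c = F 0"
  assume "F 0 \<noteq> 0"
  then have "quadf P c > 0"
    using P by (simp add: sym_pos_def_mat_def quadf_def c_def)
  txt \<open>Along the ray \<open>t c\<close> the derivative is \<open>t \<phi> (F (t c))\<close>, and \<open>\<phi> (F (t c))\<close> tends to
    \<open>\<phi> c = 2 c\<^sup>T P c > 0\<close> as \<open>t \<rightarrow> 0\<^sup>+\<close>.\<close>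
  define \<phi> where "\<phi> v = v \<bullet> (P *v c) + c \<bullet> (P *v v)" for v
  have scale: "frechet_derivative (quadf P) (at (t *\<^sub>R c)) v = t * \<phi> v" for t v
    by (simp add: frechet_derivative_quadf \<phi>_def algebra_simps)
  have "((\<lambda>t. F (t *\<^sub>R c)) \<longlongrightarrow> c) (at_right 0)"
    unfolding c_def by (rule isCont_tendsto_compose[OF F]) (auto intro!: tendsto_eq_intros)
  then have "((\<lambda>t. \<phi> (F (t *\<^sub>R c))) \<longlongrightarrow> \<phi> c) (at_right 0)"
    unfolding \<phi>_def by (intro tendsto_intros bounded_linear.tendsto[OF matrix_vector_mul_bounded_linear])
  moreover have "\<phi> c > 0"
    using \<open>quadf P c > 0\<close> by (simp add: \<phi>_def quadf_def)
  ultimately have "\<forall>\<^sub>F t in at_right 0. 0 < t \<and> 0 < \<phi> (F (t *\<^sub>R c))"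
    by (intro eventually_conj eventually_at_right_less order_tendstoD(1))
  then obtain t where "0 < t" "0 < \<phi> (F (t *\<^sub>R c))"
    using eventually_happens[of _ "at_right (0::real)"] by auto
  then have "0 < frechet_derivative (quadf P) (at (t *\<^sub>R c)) (F (t *\<^sub>R c))"
    by (simp add: scale)
  then show False
    using nonpos[of "t *\<^sub>R c"] by linarith
qed

locale lipschitz_feedback_plant =
  fixes f :: "'x::real_normed_vector \<Rightarrow> 'z::real_normed_vector \<Rightarrow> 'u::real_normed_vector \<Rightarrow> 'x"
    and h :: "'x \<Rightarrow> 'u \<Rightarrow> 'z" and k :: "'x \<Rightarrow> 'u"
    and Lf Lh Lk :: real
  assumes lipschitz_f: "Lf-lipschitz_on UNIV (\<lambda>(x, z, u). f x z u)"
    and lipschitz_h: "Lh-lipschitz_on UNIV (\<lambda>(x, u). h x u)"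
    and lipschitz_k: "Lk-lipschitz_on UNIV k"
begin

lemma lipschitz_constants_nonneg: "Lf \<ge> 0" "Lh \<ge> 0" "Lk \<ge> 0"
  using lipschitz_f lipschitz_h lipschitz_k by (auto intro: lipschitz_on_nonneg)

lemma root_shift_le: "norm (h x (k (x + e)) - h x (k x)) \<le> Lh * Lk * norm e"
proof -
  have "norm (h x (k (x + e)) - h x (k x)) \<le> Lh * norm (k (x + e) - k x)"
    using lipschitz_on_uncurried_le[OF lipschitz_h, of x "k (x + e)" x "k x"] by simp
  also have "\<dots> \<le> Lh * (Lk * norm e)"
    using lipschitz_on_normD[OF lipschitz_k, of "x + e" x] lipschitz_constants_nonneg
    by (intro mult_left_mono) auto
  finally show ?thesis
    by (simp add: mult.assoc)
qed

lemma fs_fun_shift_le: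
  "norm (fs_fun f h k x e - fs_fun f h k x 0) \<le> Lf * (Lh * Lk + Lk) * norm e"
proof -
  have "norm (fs_fun f h k x e - fs_fun f h k x 0)
      \<le> Lf * (norm (h x (k (x + e)) - h x (k x)) + norm (k (x + e) - k x))"
    using lipschitz_on_uncurried3_le[OF lipschitz_f, of x "h x (k (x + e))" "k (x + e)" x]
    by (simp add: fs_fun_def)
  also have "\<dots> \<le> Lf * (Lh * Lk * norm e + Lk * norm e)"
    using root_shift_le lipschitz_on_normD[OF lipschitz_k, of "x + e" x] lipschitz_constants_nonneg
    by (intro mult_left_mono add_mono) auto
  finally show ?thesis
    by (simp add: algebra_simps)
qed

lemma fx_fun_fs_fun_le: "norm (fx_fun f h k x y e - fs_fun f h k x e) \<le> Lf * norm y"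
  using lipschitz_on_uncurried3_le[OF lipschitz_f,
      of x "y + h x (k (x + e))" "k (x + e)" x "h x (k (x + e))" "k (x + e)"]
  by (simp add: fx_fun_def fs_fun_def)

lemma lipschitz_fs_fun_zero:
  "(Lf * (1 + Lh * (1 + Lk) + Lk))-lipschitz_on UNIV (\<lambda>x. fs_fun f h k x 0)"
proof (rule lipschitz_onI)
  fix x x' :: 'x
  have k: "norm (k x - k x') \<le> Lk * norm (x - x')"
    by (rule lipschitz_on_normD[OF lipschitz_k]) auto
  have "norm (h x (k x) - h x' (k x')) \<le> Lh * (norm (x - x') + norm (k x - k x'))"
    by (rule lipschitz_on_uncurried_le[OF lipschitz_h])
  also have "\<dots> \<le> Lh * (norm (x - x') + Lk * norm (x - x'))"
    using k lipschitz_constants_nonneg by (intro mult_left_mono) auto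
  finally have "norm (h x (k x) - h x' (k x')) \<le> Lh * (norm (x - x') + Lk * norm (x - x'))" .
  then have "Lf * (norm (x - x') + norm (h x (k x) - h x' (k x')) + norm (k x - k x'))
      \<le> Lf * (norm (x - x') + Lh * (norm (x - x') + Lk * norm (x - x')) + Lk * norm (x - x'))"
    using k lipschitz_constants_nonneg by (intro mult_left_mono add_mono) auto
  then have "norm (fs_fun f h k x 0 - fs_fun f h k x' 0)
      \<le> Lf * (norm (x - x') + Lh * (norm (x - x') + Lk * norm (x - x')) + Lk * norm (x - x'))"
    using lipschitz_on_uncurried3_le[OF lipschitz_f, of x "h x (k x)" "k x" x' "h x' (k x')" "k x'"]
    unfolding fs_fun_def add_0_right by linarith
  then show "dist (fs_fun f h k x 0) (fs_fun f h k x' 0) \<le> Lf * (1 + Lh * (1 + Lk) + Lk) * dist x x'"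
    by (simp add: dist_norm algebra_simps)
qed (use lipschitz_constants_nonneg in auto)

lemma isCont_fs_fun_zero: "isCont (\<lambda>x. fs_fun f h k x 0) x"
  using lipschitz_on_continuous_on[OF lipschitz_fs_fun_zero] by (simp add: continuous_on_eq_continuous_at)

lemma fx_fun_le:
  assumes "fs_fun f h k 0 0 = 0"
  shows "norm (fx_fun f h k x y e)
    \<le> Lf * (1 + Lh * (1 + Lk) + Lk) * norm x + Lf * (Lh * Lk + Lk) * norm e + Lf * norm y"
proof -
  have "fx_fun f h k x y e = (fx_fun f h k x y e - fs_fun f h k x e)
      + (fs_fun f h k x e - fs_fun f h k x 0) + (fs_fun f h k x 0 - fs_fun f h k 0 0)"
    using assms by simp
  then have "norm (fx_fun f h k x y e) \<le> norm (fx_fun f h k x y e - fs_fun f h k x e)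
      + norm (fs_fun f h k x e - fs_fun f h k x 0) + norm (fs_fun f h k x 0 - fs_fun f h k 0 0)"
    by (metis norm_triangle_le norm_triangle_ineq add_right_mono)
  then show ?thesis
    using fx_fun_fs_fun_le[of x y e] fs_fun_shift_le[of x e]
      lipschitz_on_normD[OF lipschitz_fs_fun_zero, of x 0]
    by simp
qed

end

lemma A2_quadf:
  assumes P: "sym_pos_def_mat P" and "\<alpha> > 0" and "K \<ge> 0"
    and decrease: "\<And>x. frechet_derivative (quadf P) (at x) (fs_fun f h k x 0) \<le> - \<alpha> * quadf P x"
    and shift: "\<And>x e. norm (fs_fun f h k x e - fs_fun f h k x 0) \<le> K * norm e"
  shows "\<exists>\<gamma>>0. A2 f h k (quadf P) (\<alpha> / 2) (\<lambda>s. \<gamma> * s\<^sup>2)"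
proof -
  obtain c where c: "c > 0" "\<And>x. c * (norm x)\<^sup>2 \<le> quadf P x"
    using quadf_ge[OF P] by blast
  define B where "B = onorm ((*v) P)"
  define \<gamma> where "\<gamma> = 2 * B\<^sup>2 * K\<^sup>2 / (\<alpha> * c) + 1"
  have "0 \<le> 2 * B\<^sup>2 * K\<^sup>2 / (\<alpha> * c)"
    using \<open>\<alpha> > 0\<close> c(1) by simp
  then have "\<gamma> > 0"
    by (simp add: \<gamma>_def)
  have decay: "frechet_derivative (quadf P) (at x) (fs_fun f h k x e)
      \<le> - (\<alpha> / 2) * quadf P x + \<gamma> * (norm e)\<^sup>2" for x e
  proof -
    let ?D = "frechet_derivative (quadf P) (at x)"
    define r where "r = fs_fun f h k x e - fs_fun f h k x 0"
    have "?D (fs_fun f h k x e) = ?D (fs_fun f h k x 0) + ?D r"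
      by (simp add: r_def linear_diff[OF linear_frechet_derivative_quadf])
    moreover have "?D r \<le> 2 * B * norm x * norm r"
      using frechet_derivative_quadf_le[of P x r] by (simp add: B_def)
    moreover have "2 * B * norm x * norm r \<le> 2 * B * norm x * (K * norm e)"
      using shift[of x e] onorm_matrix_vector_nonneg[of P] by (simp add: r_def B_def mult_left_mono)
    moreover have "2 * B * norm x * (K * norm e)
        \<le> (\<alpha> * c / 2) * (norm x)\<^sup>2 + (2 * B\<^sup>2 * K\<^sup>2 / (\<alpha> * c)) * (norm e)\<^sup>2"
      using mult_le_weighted_squares[of "\<alpha> * c / 2" "norm x" "2 * B * K * norm e"] \<open>\<alpha> > 0\<close> c(1)
      by (simp add: power_mult_distrib mult_ac)
    moreover have "(\<alpha> * c / 2) * (norm x)\<^sup>2 \<le> (\<alpha> / 2) * quadf P x"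
    proof -
      have "(\<alpha> * c / 2) * (norm x)\<^sup>2 = (\<alpha> / 2) * (c * (norm x)\<^sup>2)"
        by simp
      also have "\<dots> \<le> (\<alpha> / 2) * quadf P x"
        using c(2)[of x] \<open>\<alpha> > 0\<close> by (intro mult_left_mono) auto
      finally show ?thesis .
    qed
    moreover have "(2 * B\<^sup>2 * K\<^sup>2 / (\<alpha> * c)) * (norm e)\<^sup>2 \<le> \<gamma> * (norm e)\<^sup>2"
      unfolding \<gamma>_def by (intro mult_right_mono) auto
    ultimately show ?thesis
      using decrease[of x] by linarith
  qed
  have "\<alpha> / 2 > 0"
    using \<open>\<alpha> > 0\<close> by simp
  have "A2 f h k (quadf P) (\<alpha> / 2) (\<lambda>s. \<gamma> * s\<^sup>2)"
    unfolding A2_def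
    by (intro conjI allI C1_quadf quadf_bounded_by_Kinf[OF P] Kinf_scaled_square[OF \<open>\<gamma> > 0\<close>]
        C1_scaled_square \<open>\<alpha> / 2 > 0\<close> decay)
  with \<open>\<gamma> > 0\<close> show ?thesis
    by blast
qed

lemma A3_quadf:
  assumes P: "sym_pos_def_mat P" and "\<alpha> > 0"
    and "\<And>x y e. frechet_derivative (quadf P) (at y) (gf_fun g h k x y e) \<le> - \<alpha> * quadf P y"
  shows "A3 g h k (\<lambda>x y. quadf P y)"
proof -
  have "C1 (\<lambda>(x, y). quadf P y)"
    using C1_compose_snd[OF C1_quadf] by (simp add: case_prod_unfold)
  moreover obtain la ua where "Kinf la" "Kinf ua"
    and "\<forall>y. la (norm y) \<le> quadf P y \<and> quadf P y \<le> ua (norm y)"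
    using quadf_bounded_by_Kinf[OF P] by blast
  ultimately show ?thesis
    unfolding A3_def using assms(2,3)
    by (intro conjI exI[of _ la] exI[of _ ua] exI[of _ \<alpha>]) auto
qed

lemma sqrt_quadf_mult_ge:
  assumes "s1 > 0" "\<And>x. s1 * norm x \<le> sqrt (quadf P1 x)"
    and "s2 > 0" "\<And>y. s2 * norm y \<le> sqrt (quadf P2 y)"
  shows "s1 * s2 * (norm x * norm y) \<le> sqrt (quadf P1 x * quadf P2 y)"
proof -
  have "0 \<le> s2 * norm y"
    using assms(3) by simp
  moreover have "0 \<le> sqrt (quadf P1 x)"
    using assms(1) assms(2)[of x] by (meson less_imp_le mult_nonneg_nonneg norm_ge_zero order_trans)
  ultimately have "s1 * norm x * (s2 * norm y) \<le> sqrt (quadf P1 x) * sqrt (quadf P2 y)"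
    by (intro mult_mono assms(2,4))
  then show ?thesis
    by (simp add: real_sqrt_mult mult_ac)
qed

lemma A4_Vx_estimate:
  assumes P1: "sym_pos_def_mat P1" and P2: "sym_pos_def_mat P2" and "c \<ge> 0"
    and fx_fs: "\<And>x y e. norm (fx_fun f h k x y e - fs_fun f h k x e) \<le> c * norm y"
  shows "\<exists>\<beta>>0. \<forall>x y e. frechet_derivative (quadf P1) (at x) (fx_fun f h k x y e - fs_fun f h k x e)
      \<le> \<beta> * sqrt (quadf P1 x * quadf P2 y)"
proof -
  obtain s1 where s1: "s1 > 0" "\<And>x. s1 * norm x \<le> sqrt (quadf P1 x)"
    using sqrt_quadf_ge[OF P1] by blast
  obtain s2 where s2: "s2 > 0" "\<And>y. s2 * norm y \<le> sqrt (quadf P2 y)"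
    using sqrt_quadf_ge[OF P2] by blast
  define B where "B = onorm ((*v) P1)"
  have "B \<ge> 0"
    by (simp add: B_def onorm_matrix_vector_nonneg)
  define \<beta> where "\<beta> = 2 * B * c / (s1 * s2) + 1"
  have "\<beta> > 0"
    unfolding \<beta>_def using assms \<open>B \<ge> 0\<close> s1 s2 by (auto intro!: add_nonneg_pos divide_nonneg_pos)
  moreover have "frechet_derivative (quadf P1) (at x) (fx_fun f h k x y e - fs_fun f h k x e)
      \<le> \<beta> * sqrt (quadf P1 x * quadf P2 y)" for x y e
  proof -
    have "frechet_derivative (quadf P1) (at x) (fx_fun f h k x y e - fs_fun f h k x e)
        \<le> 2 * B * norm x * norm (fx_fun f h k x y e - fs_fun f h k x e)"
      using frechet_derivative_quadf_le[of P1 x] by (simp add: B_def abs_le_iff)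
    also have "\<dots> \<le> 2 * B * norm x * (c * norm y)"
      using fx_fs \<open>B \<ge> 0\<close> by (intro mult_left_mono) auto
    also have "\<dots> = (2 * B * c) * (norm x * norm y)"
      by (simp add: mult_ac)
    also have "\<dots> \<le> \<beta> * sqrt (quadf P1 x * quadf P2 y)"
      unfolding \<beta>_def using assms \<open>B \<ge> 0\<close> s1 s2 sqrt_quadf_mult_ge[OF s1 s2]
      by (intro le_scaled_bound) auto
    finally show ?thesis .
  qed
  ultimately show ?thesis
    by blast
qed

lemma A4_Vy_estimate:
  assumes P1: "sym_pos_def_mat P1" and P2: "sym_pos_def_mat P2"
    and "a \<ge> 0" "b \<ge> 0" "c \<ge> 0" "L \<ge> 0"
    and fx: "\<And>x y e. norm (fx_fun f h k x y e) \<le> a * norm x + b * norm e + c * norm y"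
    and dh: "\<And>x u v. norm (frechet_derivative (\<lambda>x'. h x' u) (at x) v) \<le> L * norm v"
  shows "\<exists>\<beta>2>0. \<exists>\<beta>3>0. \<exists>\<gamma>2>0. \<forall>x y e.
      - frechet_derivative (quadf P2) (at y)
          (frechet_derivative (\<lambda>x'. h x' (k (x + e))) (at x) (fx_fun f h k x y e))
      \<le> \<beta>2 * sqrt (quadf P1 x * quadf P2 y) + \<beta>3 * quadf P2 y + \<gamma>2 * (norm e)\<^sup>2"
proof -
  obtain s1 where s1: "s1 > 0" "\<And>x. s1 * norm x \<le> sqrt (quadf P1 x)"
    using sqrt_quadf_ge[OF P1] by blast
  obtain s2 where s2: "s2 > 0" "\<And>y. s2 * norm y \<le> sqrt (quadf P2 y)"
    using sqrt_quadf_ge[OF P2] by blast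
  obtain c2 where c2: "c2 > 0" "\<And>y. c2 * (norm y)\<^sup>2 \<le> quadf P2 y"
    using quadf_ge[OF P2] by blast
  define B where "B = onorm ((*v) P2)"
  have "B \<ge> 0"
    by (simp add: B_def onorm_matrix_vector_nonneg)
  define \<beta>2 where "\<beta>2 = 2 * B * L * a / (s1 * s2) + 1"
  define \<beta>3 where "\<beta>3 = (2 * B * L * c + B * L * b) / c2 + 1"
  define \<gamma>2 where "\<gamma>2 = B * L * b + 1"
  have pos: "\<beta>2 > 0" "\<beta>3 > 0" "\<gamma>2 > 0"
    unfolding \<beta>2_def \<beta>3_def \<gamma>2_def using assms \<open>B \<ge> 0\<close> s1 s2 c2
    by (auto intro!: add_nonneg_pos divide_nonneg_pos)
  have "- frechet_derivative (quadf P2) (at y) w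
      \<le> \<beta>2 * sqrt (quadf P1 x * quadf P2 y) + \<beta>3 * quadf P2 y + \<gamma>2 * (norm e)\<^sup>2"
    if w: "w = frechet_derivative (\<lambda>x'. h x' (k (x + e))) (at x) (fx_fun f h k x y e)" for x y e w
  proof -
    have "- frechet_derivative (quadf P2) (at y) w \<le> 2 * B * norm y * norm w"
      using frechet_derivative_quadf_le[of P2 y w] by (simp add: B_def abs_le_iff)
    also have "\<dots> \<le> 2 * B * norm y * (L * (a * norm x + b * norm e + c * norm y))"
      using order_trans[OF dh mult_left_mono[OF fx \<open>L \<ge> 0\<close>]] \<open>B \<ge> 0\<close>
      by (intro mult_left_mono) (auto simp: w)
    also have "\<dots> = (2 * B * L * a) * (norm x * norm y) + (2 * B * L * b) * (norm y * norm e)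
        + (2 * B * L * c) * (norm y)\<^sup>2"
      by (simp add: algebra_simps power2_eq_square)
    also have "\<dots> \<le> \<beta>2 * sqrt (quadf P1 x * quadf P2 y) + \<beta>3 * quadf P2 y + \<gamma>2 * (norm e)\<^sup>2"
    proof -
      have "(2 * B * L * a) * (norm x * norm y) \<le> \<beta>2 * sqrt (quadf P1 x * quadf P2 y)"
        unfolding \<beta>2_def using assms \<open>B \<ge> 0\<close> s1 s2 sqrt_quadf_mult_ge[OF s1 s2]
        by (intro le_scaled_bound) auto
      moreover have "(2 * B * L * b) * (norm y * norm e)
          \<le> (2 * B * L * b) * ((norm y)\<^sup>2 / 2 + (norm e)\<^sup>2 / 2)"
        using mult_le_weighted_squares[of "1 / 2" "norm y" "norm e"] assms \<open>B \<ge> 0\<close>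
        by (intro mult_left_mono) auto
      moreover have "(2 * B * L * c + B * L * b) * (norm y)\<^sup>2 \<le> \<beta>3 * quadf P2 y"
        unfolding \<beta>3_def using assms \<open>B \<ge> 0\<close> c2 by (intro le_scaled_bound) auto
      moreover have "(B * L * b) * (norm e)\<^sup>2 \<le> \<gamma>2 * (norm e)\<^sup>2"
        by (simp add: \<gamma>2_def mult_right_mono)
      ultimately show ?thesis
        by (simp add: algebra_simps)
    qed
    finally show ?thesis .
  qed
  with pos show ?thesis
    by (intro exI[of _ \<beta>2] exI[of _ \<beta>3] exI[of _ \<gamma>2] conjI allI) auto
qed

lemma A4_quadf:
  assumes P1: "sym_pos_def_mat P1" and P2: "sym_pos_def_mat P2" and "\<gamma>1 > 0"
    and "a \<ge> 0" "b \<ge> 0" "c \<ge> 0" "L \<ge> 0"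
    and fx_fs: "\<And>x y e. norm (fx_fun f h k x y e - fs_fun f h k x e) \<le> c * norm y"
    and fx: "\<And>x y e. norm (fx_fun f h k x y e) \<le> a * norm x + b * norm e + c * norm y"
    and dh: "\<And>x u v. norm (frechet_derivative (\<lambda>x'. h x' u) (at x) v) \<le> L * norm v"
  shows "\<exists>\<gamma>2>0. A4 f h k (quadf P1) (\<lambda>x y. quadf P2 y) (\<lambda>s. \<gamma>1 * s\<^sup>2) (\<lambda>s. \<gamma>2 * s\<^sup>2)"
proof -
  obtain \<beta>1 where "\<beta>1 > 0" and Vx_estimate: "\<forall>x y e.
      frechet_derivative (quadf P1) (at x) (fx_fun f h k x y e - fs_fun f h k x e)
      \<le> \<beta>1 * sqrt (quadf P1 x * quadf P2 y)"
    using A4_Vx_estimate[OF P1 P2 \<open>c \<ge> 0\<close> fx_fs] by blast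
  obtain \<beta>2 \<beta>3 \<gamma>2 where "\<beta>2 > 0" "\<beta>3 > 0" "\<gamma>2 > 0" and Vy_estimate: "\<forall>x y e.
      - frechet_derivative (quadf P2) (at y)
          (frechet_derivative (\<lambda>x'. h x' (k (x + e))) (at x) (fx_fun f h k x y e))
      \<le> \<beta>2 * sqrt (quadf P1 x * quadf P2 y) + \<beta>3 * quadf P2 y + \<gamma>2 * (norm e)\<^sup>2"
    using A4_Vy_estimate[OF P1 P2 assms(4-7) fx dh] by blast
  have "frechet_derivative (\<lambda>x'. quadf P2 y) (at x) = (\<lambda>_. 0)" for x y
    by (rule frechet_derivative_at[OF has_derivative_const, symmetric])
  then have Vy_estimate': "frechet_derivative (\<lambda>x'. quadf P2 y) (at x) (fx_fun f h k x y e)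
      - frechet_derivative (quadf P2) (at y)
          (frechet_derivative (\<lambda>x'. h x' (k (x + e))) (at x) (fx_fun f h k x y e))
      \<le> \<beta>2 * sqrt (quadf P1 x * quadf P2 y) + \<beta>3 * quadf P2 y + \<gamma>2 * (norm e)\<^sup>2" for x y e
    using Vy_estimate by simp
  have gain: "\<gamma>2 * (inv_into {0..} (\<lambda>s. \<gamma>1 * s\<^sup>2) s)\<^sup>2 \<le> (\<gamma>2 / \<gamma>1) * s" if "s \<ge> 0" for s
    using inv_into_scaled_square[OF \<open>\<gamma>1 > 0\<close> that] \<open>\<gamma>1 > 0\<close> that by simp
  have "\<gamma>2 / \<gamma>1 > 0"
    using \<open>\<gamma>2 > 0\<close> \<open>\<gamma>1 > 0\<close> by simp
  then have "A4 f h k (quadf P1) (\<lambda>x y. quadf P2 y) (\<lambda>s. \<gamma>1 * s\<^sup>2) (\<lambda>s. \<gamma>2 * s\<^sup>2)"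
    unfolding A4_def
    by (intro conjI exI[of _ \<beta>1] exI[of _ \<beta>2] exI[of _ \<beta>3] exI[of _ "\<gamma>2 / \<gamma>1"] allI impI
        Kinf_scaled_square \<open>\<gamma>2 > 0\<close> \<open>\<beta>1 > 0\<close> \<open>\<beta>2 > 0\<close> \<open>\<beta>3 > 0\<close>
        Vx_estimate[rule_format] Vy_estimate' gain)
  with \<open>\<gamma>2 > 0\<close> show ?thesis
    by blast
qed

lemma A5_quadf:
  assumes P: "sym_pos_def_mat P" and "\<gamma> > 0" and "M \<ge> 0"
    and shift: "\<And>x e. norm (h x (k (x + e)) - h x (k x)) \<le> M * norm e"
  shows "A5 h k (\<lambda>x y. quadf P y) (\<lambda>s. \<gamma> * s\<^sup>2)"
proof -
  obtain s where s: "s > 0" "\<And>y. s * norm y \<le> sqrt (quadf P y)"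
    using sqrt_quadf_ge[OF P] by blast
  define B where "B = onorm ((*v) P)"
  have "B \<ge> 0"
    by (simp add: B_def onorm_matrix_vector_nonneg)
  define lam1 where "lam1 = B * M\<^sup>2 / \<gamma> + 1"
  define lam2 where "lam2 = 2 * B * M / (sqrt \<gamma> * s) + 1"
  have pos: "lam1 > 0" "lam2 > 0"
    unfolding lam1_def lam2_def using assms \<open>B \<ge> 0\<close> s
    by (auto intro!: add_nonneg_pos divide_nonneg_pos)
  have "quadf P (hy_fun h k x y e)
      \<le> quadf P y + lam1 * (\<gamma> * (norm e)\<^sup>2) + lam2 * sqrt (\<gamma> * (norm e)\<^sup>2 * quadf P y)" for x y e
  proof -
    define d where "d = h x (k (x + e)) - h x (k x)"
    have d: "norm d \<le> M * norm e"
      using shift by (simp add: d_def)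
    have "quadf P (hy_fun h k x y e) \<le> quadf P y + 2 * B * norm y * norm d + B * (norm d)\<^sup>2"
      using quadf_add_le[of P y d] by (simp add: hy_fun_def d_def B_def add_diff_eq)
    moreover have "2 * B * norm y * norm d \<le> lam2 * sqrt (\<gamma> * (norm e)\<^sup>2 * quadf P y)"
    proof -
      have "2 * B * norm y * norm d \<le> (2 * B * M) * (norm e * norm y)"
        using mult_left_mono[OF d, of "2 * B * norm y"] \<open>B \<ge> 0\<close> by (simp add: mult_ac)
      also have "\<dots> \<le> lam2 * sqrt (\<gamma> * (norm e)\<^sup>2 * quadf P y)"
        unfolding lam2_def
      proof (intro le_scaled_bound)
        show "sqrt \<gamma> * s * (norm e * norm y) \<le> sqrt (\<gamma> * (norm e)\<^sup>2 * quadf P y)"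
          using mult_left_mono[OF s(2)[of y], of "norm e"] \<open>\<gamma> > 0\<close>
          by (simp add: real_sqrt_mult mult_ac)
      qed (use assms \<open>B \<ge> 0\<close> s in auto)
      finally show ?thesis .
    qed
    moreover have "B * (norm d)\<^sup>2 \<le> lam1 * (\<gamma> * (norm e)\<^sup>2)"
    proof -
      have "B * (norm d)\<^sup>2 \<le> B * (M * norm e)\<^sup>2"
        using d \<open>B \<ge> 0\<close> by (intro mult_left_mono power_mono) auto
      also have "\<dots> = (B * M\<^sup>2) * (norm e)\<^sup>2"
        by (simp add: power_mult_distrib)
      also have "\<dots> \<le> lam1 * (\<gamma> * (norm e)\<^sup>2)"
        unfolding lam1_def using assms \<open>B \<ge> 0\<close> by (intro le_scaled_bound) auto
      finally show ?thesis .
    qed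
    ultimately show ?thesis
      by linarith
  qed
  then show ?thesis
    unfolding A5_def using pos by (intro exI[of _ lam1] exI[of _ lam2]) auto
qed

lemma A6_quadf:
  assumes P1: "sym_pos_def_mat P1" and P2: "sym_pos_def_mat P2"
    and "a \<ge> 0" "b \<ge> 0" "c \<ge> 0"
    and fx: "\<And>x y e. norm (fx_fun f h k x y e) \<le> a * norm x + b * norm e + c * norm y"
  shows "A6 f h k (quadf P1) (\<lambda>x y. quadf P2 y)"
proof -
  obtain s1 where s1: "s1 > 0" "\<And>x. s1 * norm x \<le> sqrt (quadf P1 x)"
    using sqrt_quadf_ge[OF P1] by blast
  obtain s2 where s2: "s2 > 0" "\<And>y. s2 * norm y \<le> sqrt (quadf P2 y)"
    using sqrt_quadf_ge[OF P2] by blast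
  define N where "N = a / s1 + c / s2"
  have "N \<ge> 0"
    using assms s1 s2 by (simp add: N_def)
  have "D (- fx_fun f h k x y e) \<le> b * norm e + N * (sqrt (quadf P1 x) + sqrt (quadf P2 y))"
    if "(norm has_derivative D) (at e)" for x y e D
  proof -
    have "D (- fx_fun f h k x y e) \<le> a * norm x + b * norm e + c * norm y"
      using has_derivative_norm_le_lipschitz[OF that lipschitz_on_norm, of "- fx_fun f h k x y e"]
        fx[of x y e] by simp
    moreover have "a * norm x \<le> (a / s1) * sqrt (quadf P1 x)"
      and "c * norm y \<le> (c / s2) * sqrt (quadf P2 y)"
      using mult_left_mono[OF s1(2)[of x], of "a / s1"] mult_left_mono[OF s2(2)[of y], of "c / s2"]
        assms s1 s2
      by simp_all
    moreover have "0 \<le> (a / s1) * sqrt (quadf P2 y)" "0 \<le> (c / s2) * sqrt (quadf P1 x)"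
      using assms s1 s2 quadf_nonneg[OF P1] quadf_nonneg[OF P2] by simp_all
    ultimately show ?thesis
      by (simp add: N_def algebra_simps)
  qed
  then show ?thesis
    unfolding A6_def using \<open>b \<ge> 0\<close> \<open>N \<ge> 0\<close> by (intro exI[of _ b] exI[of _ N] conjI allI AE_I2) auto
qed

theorem proposition1:
  fixes f :: "real^'nx \<Rightarrow> real^'nz \<Rightarrow> real^'nu \<Rightarrow> real^'nx"
    and g :: "real^'nx \<Rightarrow> real^'nz \<Rightarrow> real^'nu \<Rightarrow> real^'nz"
    and k :: "real^'nx \<Rightarrow> real^'nu"
    and h :: "real^'nx \<Rightarrow> real^'nu \<Rightarrow> real^'nz"
    and P1 :: "real^'nx^'nx" and P2 :: "real^'nz^'nz"
    and \<epsilon> \<alpha>1bar \<alpha>2 :: real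
  assumes eps: "\<epsilon> > 0"
    and lip_f: "glob_lipschitz (\<lambda>(x, z, u). f x z u)"
    and lip_g: "glob_lipschitz (\<lambda>(x, z, u). g x z u)"
    and lip_k: "glob_lipschitz k"
    and a1: "A1 g h"
    and lip_h: "glob_lipschitz (\<lambda>(x, u). h x u)"
    and P1: "sym_pos_def_mat P1" and P2: "sym_pos_def_mat P2"
    and a1pos: "\<alpha>1bar > 0" and a2pos: "\<alpha>2 > 0"
    and Vx_dec: "\<forall>x. frechet_derivative (quadf P1) (at x) (fs_fun f h k x 0)
                    \<le> - \<alpha>1bar * quadf P1 x"
    and Vy_dec: "\<forall>x y e. frechet_derivative (quadf P2) (at y) (gf_fun g h k x y e)
                    \<le> - \<alpha>2 * quadf P2 y"
  shows "\<exists>\<gamma>1bar \<gamma>2bar. \<gamma>1bar \<ge> 0 \<and> \<gamma>2bar \<ge> 0 \<and>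
           (let Vx = quadf P1; Vy = (\<lambda>x y. quadf P2 y);
                \<gamma>1 = (\<lambda>s. \<gamma>1bar * s\<^sup>2); \<gamma>2 = (\<lambda>s. \<gamma>2bar * s\<^sup>2) in
              A2 f h k Vx (\<alpha>1bar / 2) \<gamma>1 \<and> A3 g h k Vy \<and> A4 f h k Vx Vy \<gamma>1 \<gamma>2
              \<and> A5 h k Vy \<gamma>1 \<and> A6 f h k Vx Vy)"
proof -
  obtain Lf Lh Lk where "Lf-lipschitz_on UNIV (\<lambda>(x, z, u). f x z u)"
    and Lh: "Lh-lipschitz_on UNIV (\<lambda>(x, u). h x u)" and "Lk-lipschitz_on UNIV k"
    using lip_f lip_h lip_k unfolding glob_lipschitz_def by blast
  then interpret lipschitz_feedback_plant f h k Lf Lh Lk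
    by unfold_locales
  note nonneg = lipschitz_constants_nonneg
  have "- \<alpha>1bar * quadf P1 x \<le> 0" for x
    using a1pos quadf_nonneg[OF P1, of x] by simp
  then have "fs_fun f h k 0 0 = 0"
    using Vx_dec by (intro quadf_derivative_nonpos_imp_zero[OF P1 isCont_fs_fun_zero]) (meson order_trans)
  note fx_growth = fx_fun_le[OF this]
  obtain \<gamma>1 where "\<gamma>1 > 0" and A2: "A2 f h k (quadf P1) (\<alpha>1bar / 2) (\<lambda>s. \<gamma>1 * s\<^sup>2)"
    using A2_quadf[OF P1 a1pos _ Vx_dec[rule_format] fs_fun_shift_le] nonneg by auto
  obtain \<gamma>2 where "\<gamma>2 > 0"
    and A4: "A4 f h k (quadf P1) (\<lambda>x y. quadf P2 y) (\<lambda>s. \<gamma>1 * s\<^sup>2) (\<lambda>s. \<gamma>2 * s\<^sup>2)"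
    using A4_quadf[OF P1 P2 \<open>\<gamma>1 > 0\<close> _ _ _ _ fx_fun_fs_fun_le fx_growth
        frechet_derivative_partial_le[OF A1_imp_C1[OF a1] Lh]] nonneg
    by auto
  have "A3 g h k (\<lambda>x y. quadf P2 y)"
    using A3_quadf[OF P2 a2pos] Vy_dec by blast
  moreover have "A5 h k (\<lambda>x y. quadf P2 y) (\<lambda>s. \<gamma>1 * s\<^sup>2)"
    using A5_quadf[where h = h and k = k, OF P2 \<open>\<gamma>1 > 0\<close> _ root_shift_le] nonneg by auto
  moreover have "A6 f h k (quadf P1) (\<lambda>x y. quadf P2 y)"
    using A6_quadf[OF P1 P2 _ _ _ fx_growth] nonneg by auto
  ultimately show ?thesis
    using A2 A4 \<open>\<gamma>1 > 0\<close> \<open>\<gamma>2 > 0\<close> by (intro exI[of _ \<gamma>1] exI[of _ \<gamma>2]) (simp add: Let_def)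
qed

end
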